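(* Let $q$ be a prime power and let $v,k,d,m$ be positive integers with $k\le v$ and $d\le k$. Let $G$ be a subgroup of $GL(v,GF(q))$. Let $\omega_1,\ldots,\omega_r$ be the orbits of $G$ on the $k$-dimensional subspaces of $GF(q)^v$ and $\Omega_1,\ldots,\Omega_t$ the orbits of $G$ on the $(k-d+1)$-dimensional subspaces of $GF(q)^v$. Let $M^G$ be the $t\times r$ integer matrix with entries $$M^G_{\Omega_i,\omega_j}=|\{V\in\omega_j : W\subseteq V\}|,$$ where $W$ is any representative of $\Omega_i$ (the value does not depend on the choice of representative). Then there is a constant dimension code of dimension $k$ in $GF(q)^v$ with $m$ codewords and minimum subspace distance at least $2d$ whose group of automorphisms contains $G$ as a subgroup if and only if there is a vector $x=(x_1,\ldots,x_r)^T\in\{0,1\}^r$ such that (1) $|\omega_1|x_1+\cdots+|\omega_r|x_r=m$, and (2) $M^Gx\le(1,\ldots,1)^T$ (componentwise).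
   Context: The subspace distance between subspaces $V,W$ of $GF(q)^v$ is $d_S(V,W)=\dim V+\dim W-2\dim(V\cap W)$. A constant dimension code of dimension $k$ in $GF(q)^v$ is a set $C$ of $k$-dimensional subspaces of $GF(q)^v$; its elements are its codewords. $C$ has minimum (subspace) distance at least $\delta$ if $d_S(V,W)\ge\delta$ for all distinct $V,W\in C$. An automorphism of $C=\{V_1,\ldots,V_m\}$ is an element $\varphi\in GL(v,GF(q))$ with $\{\varphi(V_1),\ldots,\varphi(V_m)\}=C$; the group of automorphisms of $C$ is the group of all such $\varphi$. *)

theory Defs
  imports "HOL-Analysis.Cartesian_Space" "HOL-Algebra.Group_Action"
begin

text \<open>
  The field GF(q) is a type \<open>'f\<close> of sort \<open>{field, finite}\<close> with \<open>CARD('f) = q\<close>, and the space of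
  vectors of length v over it is \<open>'f ^ 'n\<close> with \<open>CARD('n) = v\<close>. Subspaces and dimensions are the
  library's \<^const>\<open>vec.subspace\<close> and \<^const>\<open>vec.dim\<close>, which refer to the scalar
  multiplication \<^term>\<open>(*s)\<close>.
\<close>

definition GL :: "('f::field ^ 'n ^ 'n) monoid" where
  "GL = \<lparr>carrier = {A. invertible A}, monoid.mult = (**), one = mat 1\<rparr>"

lemma group_GL: "group (GL :: ('f::field ^ 'n ^ 'n) monoid)"
proof (rule groupI)
  fix A :: "'f ^ 'n ^ 'n"
  assume "A \<in> carrier GL"
  then obtain B where "A ** B = mat 1" "B ** A = mat 1"
    by (auto simp: GL_def invertible_def)
  then show "\<exists>B\<in>carrier GL. B \<otimes>\<^bsub>GL\<^esub> A = \<one>\<^bsub>GL\<^esub>"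
    by (auto simp: GL_def invertible_def)
qed (auto simp: GL_def invertible_mult matrix_mul_assoc invertible_def[of "mat 1"])

definition map_space :: "'f::field ^ 'n ^ 'n \<Rightarrow> ('f ^ 'n) set \<Rightarrow> ('f ^ 'n) set" where
  "map_space A V = (\<lambda>x. A *v x) ` V"

definition subspaces :: "nat \<Rightarrow> ('f::field ^ 'n) set set" where
  "subspaces k = {V. vec.subspace V \<and> vec.dim V = k}"

definition subspace_orbits :: "('f::field ^ 'n ^ 'n) set \<Rightarrow> nat \<Rightarrow> ('f ^ 'n) set set set" where
  "subspace_orbits G k = orbits (GL\<lparr>carrier := G\<rparr>) (subspaces k) map_space"

definition subspace_dist :: "('f::field ^ 'n) set \<Rightarrow> ('f ^ 'n) set \<Rightarrow> int" where
  "subspace_dist V W = int (vec.dim V) + int (vec.dim W) - 2 * int (vec.dim (V \<inter> W))"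

definition constant_dimension_code :: "nat \<Rightarrow> ('f::field ^ 'n) set set \<Rightarrow> bool" where
  "constant_dimension_code k C \<longleftrightarrow> C \<subseteq> subspaces k"

definition min_dist_at_least :: "('f::field ^ 'n) set set \<Rightarrow> nat \<Rightarrow> bool" where
  "min_dist_at_least C \<delta> \<longleftrightarrow> (\<forall>V\<in>C. \<forall>W\<in>C. V \<noteq> W \<longrightarrow> subspace_dist V W \<ge> int \<delta>)"

definition automorphism_group :: "('f::field ^ 'n) set set \<Rightarrow> ('f ^ 'n ^ 'n) monoid" where
  "automorphism_group C = GL\<lparr>carrier := {A \<in> carrier GL. map_space A ` C = C}\<rparr>"

text \<open>
  \<open>orbit_matrix \<Omega> \<omega> i j\<close> is the entry in row \<open>i\<close> and column \<open>j\<close> of the matrix of the numbered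
  families of orbits \<open>\<Omega>\<close> (rows) and \<open>\<omega>\<close> (columns). The representative of \<open>\<Omega> i\<close> is an arbitrary
  choice.
\<close>

definition orbit_matrix ::
  "(nat \<Rightarrow> ('f::field ^ 'n) set set) \<Rightarrow> (nat \<Rightarrow> ('f ^ 'n) set set) \<Rightarrow> nat \<Rightarrow> nat \<Rightarrow> int" where
  "orbit_matrix \<Omega> \<omega> i j = int (card {V \<in> \<omega> j. (SOME W. W \<in> \<Omega> i) \<subseteq> V})"

end

theory Submission
  imports Defs "HOL-Library.Disjoint_Sets"
begin

text \<open>
  Two k-dimensional subspaces are at distance less than 2d exactly when they share a
  (k-d+1)-dimensional subspace, so the distance condition says that every subspace of dimension
  k-d+1 lies in at most one codeword. A code invariant under G is a union of orbits, and x selects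
  these orbits: row i of the matrix applied to x counts the codewords above a representative of
  the i-th orbit.
\<close>

section \<open>Action of invertible matrices on subspaces\<close>

lemma map_space_mat_1 [simp]: "map_space (mat 1) V = V"
  by (simp add: map_space_def)

lemma map_space_mult: "map_space (A ** B) V = map_space A (map_space B V)"
  by (auto simp: map_space_def image_image matrix_vector_mul_assoc)

lemma inj_matrix_vector_mult:
  fixes A :: "'f::field ^ 'n ^ 'n"
  assumes "invertible A"
  shows "inj ((*v) A)"
  using assms matrix_left_invertible_injective unfolding invertible_def by blast

lemma map_space_subset_iff:
  assumes "invertible A"
  shows "map_space A V \<subseteq> map_space A W \<longleftrightarrow> V \<subseteq> W"
  unfolding map_space_def using inj_matrix_vector_mult[OF assms] by (rule inj_image_subset_iff)

lemma inj_map_space: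
  assumes "invertible A"
  shows "inj (map_space A)"
  using map_space_subset_iff[OF assms] by (intro injI) (metis subset_antisym subset_refl)

lemma map_space_in_subspaces:
  assumes "invertible A" "V \<in> subspaces k"
  shows "map_space A V \<in> subspaces k"
proof -
  have "vec.dim (map_space A V) = vec.dim V"
    unfolding map_space_def using inj_matrix_vector_mult[OF assms(1)]
    by (intro vec.dim_image_eq matrix_vector_mul_linear_gen) (rule inj_on_subset, auto)
  then show ?thesis
    using assms(2) by (simp add: subspaces_def map_space_def vec.subspace_image)
qed

section \<open>Minimum distance as a covering condition\<close>

lemma exists_subspace_of_dim:
  assumes "vec.subspace V" "n \<le> vec.dim V"
  obtains W where "W \<in> subspaces n" "W \<subseteq> V"
proof -
  obtain B where B: "B \<subseteq> V" "vec.independent B" "card B = vec.dim V"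
    using vec.basis_exists by metis
  obtain B' where B': "B' \<subseteq> B" "card B' = n"
    using obtain_subset_with_card_n assms(2) B(3) by metis
  have "vec.independent B'"
    using vec.independent_mono B(2) B'(1) by blast
  then have "vec.span B' \<in> subspaces n"
    using B'(2) by (simp add: subspaces_def vec.dim_eq_card_independent)
  moreover have "vec.span B' \<subseteq> V"
    using B(1) B'(1) assms(1) by (intro vec.span_minimal) auto
  ultimately show thesis
    by (rule that)
qed

text \<open>Codewords have dimension \<open>k\<close>, so two of them are at distance
  \<open>2 * k\<close> minus twice the dimension of their intersection. This is below
  \<open>2 * d\<close> exactly when the intersection has dimension more than \<open>k - d\<close>.
  As the field is finite, all sets of codewords are finite, so \<open>card\<close> at most 1 really
  says that no two codewords contain \<open>W\<close>.\<close>

lemma min_dist_at_least_iff: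
  fixes C :: "('f::{field,finite} ^ 'n) set set"
  assumes C: "C \<subseteq> subspaces k" and d: "0 < d" "d \<le> k"
  shows "min_dist_at_least C (2 * d) \<longleftrightarrow>
    (\<forall>W\<in>subspaces (k - d + 1). card {V \<in> C. W \<subseteq> V} \<le> 1)"
proof
  assume dist: "min_dist_at_least C (2 * d)"
  show "\<forall>W\<in>subspaces (k - d + 1). card {V \<in> C. W \<subseteq> V} \<le> 1"
  proof
    fix W :: "('f ^ 'n) set"
    assume W: "W \<in> subspaces (k - d + 1)"
    have "V = V'" if V: "V \<in> C" "W \<subseteq> V" "V' \<in> C" "W \<subseteq> V'" for V V'
    proof (rule ccontr)
      assume "V \<noteq> V'"
      then have "int (2 * d) \<le> subspace_dist V V'"
        using dist V by (auto simp: min_dist_at_least_def)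
      moreover have "vec.dim V = k" "vec.dim V' = k"
        using C V by (auto simp: subspaces_def)
      moreover have "k - d + 1 \<le> vec.dim (V \<inter> V')"
        using W V vec.dim_subset[of W "V \<inter> V'"] by (auto simp: subspaces_def)
      \<comment> \<open>The shared \<open>W\<close> forces the distance down to at most
        \<open>2 * d - 2\<close>.\<close>
      ultimately show False
        using d by (simp add: subspace_dist_def)
    qed
    then show "card {V \<in> C. W \<subseteq> V} \<le> 1"
      by (auto simp: card_le_Suc0_iff_eq)
  qed
next
  assume cov: "\<forall>W\<in>subspaces (k - d + 1). card {V \<in> C. W \<subseteq> V} \<le> 1"
  show "min_dist_at_least C (2 * d)"
    unfolding min_dist_at_least_def
  proof (intro ballI impI, rule ccontr)
    fix V V'
    assume V: "V \<in> C" "V' \<in> C" "V \<noteq> V'" and less: "\<not> int (2 * d) \<le> subspace_dist V V'"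
    have sub: "vec.subspace V" "vec.dim V = k" "vec.subspace V'" "vec.dim V' = k"
      using C V by (auto simp: subspaces_def)
    \<comment> \<open>The distance is an integer, the dimension bound a natural number;
      \<open>d \<le> k\<close> keeps \<open>k - d\<close> from being truncated.\<close>
    have "vec.subspace (V \<inter> V')" "k - d + 1 \<le> vec.dim (V \<inter> V')"
      using less sub d by (auto simp: subspace_dist_def vec.subspace_inter)
    then obtain W where W: "W \<in> subspaces (k - d + 1)" "W \<subseteq> V \<inter> V'"
      by (rule exists_subspace_of_dim)
    with cov V show False
      by (auto simp: card_le_Suc0_iff_eq)
  qed
qed

section \<open>Containment in the automorphism group as invariance of the code\<close>

lemma subgroup_automorphism_group_iff:
  assumes "subgroup G GL"
  shows "subgroup G (automorphism_group C) \<longleftrightarrow> (\<forall>A\<in>G. map_space A ` C = C)"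
proof
  assume "subgroup G (automorphism_group C)"
  then show "\<forall>A\<in>G. map_space A ` C = C"
    using subgroup.subset[of G "automorphism_group C"] by (force simp: automorphism_group_def)
next
  let ?H = "{A \<in> carrier GL. map_space A ` C = C}"
  interpret GL: group GL
    by (rule group_GL)
  assume inv: "\<forall>A\<in>G. map_space A ` C = C"
  \<comment> \<open>\<open>GL.subgroup_incl\<close> compares two subgroups of \<open>GL\<close>, so
    the stabilizer of \<open>C\<close> must first be shown to be one.\<close>
  have "subgroup ?H GL"
  proof
    fix A B assume "A \<in> ?H" "B \<in> ?H"
    moreover have "map_space (A \<otimes>\<^bsub>GL\<^esub> B) ` C = map_space A ` map_space B ` C"
      by (simp add: GL_def map_space_mult image_image)
    ultimately show "A \<otimes>\<^bsub>GL\<^esub> B \<in> ?H"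
      by simp
  next
    have "map_space (\<one>\<^bsub>GL\<^esub>) ` C = C"
      by (simp add: GL_def)
    then show "\<one>\<^bsub>GL\<^esub> \<in> ?H"
      by simp
  next
    fix A assume A: "A \<in> ?H"
    \<comment> \<open>Since \<open>A\<close> maps \<open>C\<close> onto \<open>C\<close>, the left
      side is the image of \<open>C\<close> under the inverse of \<open>A\<close>.\<close>
    have "map_space (inv\<^bsub>GL\<^esub> A) ` map_space A ` C = map_space (inv\<^bsub>GL\<^esub> A \<otimes>\<^bsub>GL\<^esub> A) ` C"
      by (simp add: GL_def map_space_mult image_image)
    also have "\<dots> = map_space (\<one>\<^bsub>GL\<^esub>) ` C"
      using A by simp
    also have "\<dots> = C"
      by (simp add: GL_def)
    finally show "inv\<^bsub>GL\<^esub> A \<in> ?H"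
      using A by simp
  qed auto
  moreover have "G \<subseteq> ?H"
    using subgroup.subset[OF assms] inv by auto
  ultimately show "subgroup G (automorphism_group C)"
    unfolding automorphism_group_def using assms by (intro GL.subgroup_incl)
qed

section \<open>Orbits of a matrix group on subspaces\<close>

locale linear_group =
  fixes G :: "('f::field ^ 'n ^ 'n) set"
  assumes subgroup_GL: "subgroup G GL"
begin

lemma invertible: "A \<in> G \<Longrightarrow> invertible A"
  using subgroup.subset[OF subgroup_GL] by (auto simp: GL_def)

lemma one_mem: "mat 1 \<in> G"
  using subgroup.one_closed[OF subgroup_GL] by (simp add: GL_def)

lemma mult_mem: "A \<in> G \<Longrightarrow> B \<in> G \<Longrightarrow> A ** B \<in> G"
  using subgroup.m_closed[OF subgroup_GL] by (simp add: GL_def)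

lemma inverse_mem:
  assumes "A \<in> G"
  obtains B where "B \<in> G" "A ** B = mat 1" "B ** A = mat 1"
proof
  interpret GL: group GL
    by (rule group_GL)
  have "A \<in> carrier GL"
    using assms subgroup.subset[OF subgroup_GL] by auto
  then show "A ** inv\<^bsub>GL\<^esub> A = mat 1" "inv\<^bsub>GL\<^esub> A ** A = mat 1"
    using GL.r_inv[of A] GL.l_inv[of A] by (simp_all add: GL_def)
  show "inv\<^bsub>GL\<^esub> A \<in> G"
    using assms by (rule subgroup.m_inv_closed[OF subgroup_GL])
qed

lemma subspace_orbits_eq:
  "subspace_orbits G k = (\<lambda>V. (\<lambda>A. map_space A V) ` G) ` subspaces k"
  by (auto simp: subspace_orbits_def orbits_def orbit_def)

text \<open>Right multiplication by \<open>A\<close> permutes \<open>G\<close>, so it only reindexes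
  the images of \<open>V\<close>.\<close>

lemma orbit_map_space:
  assumes "A \<in> G"
  shows "(\<lambda>B. map_space B (map_space A V)) ` G = (\<lambda>B. map_space B V) ` G"
proof -
  obtain A' where A': "A' \<in> G" "A ** A' = mat 1" "A' ** A = mat 1"
    using assms by (rule inverse_mem)
  have "(\<lambda>B. B ** A) ` G = G"
  proof
    show "(\<lambda>B. B ** A) ` G \<subseteq> G"
      using assms mult_mem by auto
    show "G \<subseteq> (\<lambda>B. B ** A) ` G"
    proof
      fix B assume "B \<in> G"
      then have "B ** A' \<in> G" "B = (B ** A') ** A"
        using A' mult_mem by (auto simp flip: matrix_mul_assoc)
      then show "B \<in> (\<lambda>B. B ** A) ` G"
        by blast
    qed
  qed
  then have "(\<lambda>B. map_space B V) ` G = (\<lambda>B. map_space B V) ` (\<lambda>B. B ** A) ` G"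
    by simp
  then show ?thesis
    by (simp add: image_image map_space_mult)
qed

text \<open>Any member can serve as base point of its orbit. Disjointness of orbits and independence
  of the chosen representative both rest on this.\<close>

lemma orbit_eq_image:
  assumes "X \<in> subspace_orbits G k" "V \<in> X"
  shows "X = (\<lambda>A. map_space A V) ` G"
proof -
  obtain U A where "X = (\<lambda>B. map_space B U) ` G" "A \<in> G" "V = map_space A U"
    using assms by (auto simp: subspace_orbits_eq)
  then show ?thesis
    using orbit_map_space by simp
qed

lemma orbit_subset_subspaces: "X \<in> subspace_orbits G k \<Longrightarrow> X \<subseteq> subspaces k"
  using map_space_in_subspaces invertible by (auto simp: subspace_orbits_eq)

lemma Union_subspace_orbits: "\<Union> (subspace_orbits G k) = subspaces k"
proof
  show "\<Union> (subspace_orbits G k) \<subseteq> subspaces k"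
    using orbit_subset_subspaces by blast
  have "V \<in> (\<lambda>A. map_space A V) ` G" for V
    using one_mem by (intro image_eqI[of _ _ "mat 1"]) auto
  then show "subspaces k \<subseteq> \<Union> (subspace_orbits G k)"
    by (auto simp: subspace_orbits_eq)
qed

lemma orbit_nonempty: "X \<in> subspace_orbits G k \<Longrightarrow> X \<noteq> {}"
  using one_mem by (auto simp: subspace_orbits_eq)

lemma disjoint_subspace_orbits: "disjoint (subspace_orbits G k)"
proof (rule disjointI)
  fix X Y assume "X \<in> subspace_orbits G k" "Y \<in> subspace_orbits G k" "X \<noteq> Y"
  then show "X \<inter> Y = {}"
    \<comment> \<open>A common member \<open>V\<close> would make both \<open>X\<close> and
      \<open>Y\<close> the orbit of \<open>V\<close>.\<close>
    by (metis disjoint_iff orbit_eq_image)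
qed

text \<open>Closure of \<open>G\<close> under products gives one inclusion for every element of
  \<open>G\<close>; the inclusion for the inverse of \<open>A\<close> yields the other one for
  \<open>A\<close>.\<close>

lemma map_space_image_orbit:
  assumes "X \<in> subspace_orbits G k" "A \<in> G"
  shows "map_space A ` X = X"
proof -
  have sub: "map_space B ` X \<subseteq> X" if "B \<in> G" for B
    using assms(1) that mult_mem by (auto simp: subspace_orbits_eq simp flip: map_space_mult)
  obtain B where B: "B \<in> G" "A ** B = mat 1"
    using assms(2) by (rule inverse_mem)
  have "X = map_space A ` map_space B ` X"
    by (simp add: image_image B(2) flip: map_space_mult)
  also have "\<dots> \<subseteq> map_space A ` X"
    using sub[OF B(1)] by (rule image_mono)
  finally show ?thesis
    using sub[OF assms(2)] by (intro subset_antisym)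
qed

text \<open>\<open>A\<close> permutes the orbit \<open>X\<close> and preserves and reflects
  inclusion, so it maps the members above \<open>W\<close> bijectively to those above the image of
  \<open>W\<close>.\<close>

lemma card_orbit_supersets_map_space:
  assumes "X \<in> subspace_orbits G k" "A \<in> G"
  shows "card {V \<in> X. map_space A W \<subseteq> V} = card {V \<in> X. W \<subseteq> V}"
proof -
  have A: "invertible A"
    using assms(2) by (rule invertible)
  have "{V \<in> X. map_space A W \<subseteq> V} = {V \<in> map_space A ` X. map_space A W \<subseteq> V}"
    using map_space_image_orbit[OF assms] by simp
  also have "\<dots> = map_space A ` {V \<in> X. W \<subseteq> V}"
    using map_space_subset_iff[OF A] by auto
  finally show ?thesis
    using card_image[OF inj_on_subset[OF inj_map_space[OF A] subset_UNIV]] by simp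
qed

text \<open>The representative picked by \<open>SOME\<close> is the image of \<open>W\<close> under
  some element of \<open>G\<close>, which leaves the count unchanged. Thus the matrix is well
  defined.\<close>

lemma orbit_matrix_eq:
  assumes "\<omega> j \<in> subspace_orbits G k" "\<Omega> i \<in> subspace_orbits G l" "W \<in> \<Omega> i"
  shows "orbit_matrix \<Omega> \<omega> i j = int (card {V \<in> \<omega> j. W \<subseteq> V})"
proof -
  have "(SOME W. W \<in> \<Omega> i) \<in> \<Omega> i"
    using assms(3) by (rule someI)
  moreover have "\<Omega> i = (\<lambda>A. map_space A W) ` G"
    using assms(2,3) by (rule orbit_eq_image)
  ultimately obtain A where "A \<in> G" "(SOME W. W \<in> \<Omega> i) = map_space A W"
    by (metis (no_types, lifting) imageE)
  then show ?thesis
    using card_orbit_supersets_map_space[OF assms(1)] by (simp add: orbit_matrix_def)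
qed

section \<open>Invariant codes as unions of selected orbits\<close>

lemma invariant_code_eq_Union_orbits:
  assumes "C \<subseteq> subspaces k" "\<forall>A\<in>G. map_space A ` C = C"
  shows "C = \<Union> {X \<in> subspace_orbits G k. X \<subseteq> C}"
proof
  show "C \<subseteq> \<Union> {X \<in> subspace_orbits G k. X \<subseteq> C}"
  proof
    fix V assume V: "V \<in> C"
    then obtain X where X: "X \<in> subspace_orbits G k" "V \<in> X"
      using assms(1) Union_subspace_orbits by blast
    \<comment> \<open>\<open>X\<close> consists of the images of \<open>V\<close> under
      \<open>G\<close>, and invariance keeps these in \<open>C\<close>.\<close>
    have "X \<subseteq> C"
      using orbit_eq_image[OF X] assms(2) V by blast
    with X show "V \<in> \<Union> {X \<in> subspace_orbits G k. X \<subseteq> C}"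
      by blast
  qed
qed blast

end

text \<open>Coefficients 0 drop out and disjointness turns the remaining sum into the size of a
  union. The predicate \<open>P\<close> lets one count serve both conditions on \<open>x\<close>:
  the constantly true one gives the code size, containment of \<open>W\<close> gives a row of the
  matrix.\<close>

lemma sum_card_selected:
  fixes x :: "'i \<Rightarrow> int"
  assumes "finite I" "disjoint_family_on F I" "\<And>i. i \<in> I \<Longrightarrow> finite (F i)"
    and "\<And>i. i \<in> I \<Longrightarrow> x i \<in> {0, 1}"
  shows "(\<Sum>i\<in>I. int (card {a \<in> F i. P a}) * x i) =
    int (card {a \<in> (\<Union>i\<in>{i\<in>I. x i = 1}. F i). P a})"
proof -
  let ?J = "{i\<in>I. x i = 1}"
  have "(\<Sum>i\<in>I. int (card {a \<in> F i. P a}) * x i) = (\<Sum>i\<in>?J. int (card {a \<in> F i. P a}) * x i)"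
    using assms(1,4) by (intro sum.mono_neutral_right) auto
  also have "\<dots> = int (\<Sum>i\<in>?J. card {a \<in> F i. P a})"
    by simp
  also have "(\<Sum>i\<in>?J. card {a \<in> F i. P a}) = card (\<Union>i\<in>?J. {a \<in> F i. P a})"
    using assms(1-3) by (intro card_UN_disjoint[symmetric]) (auto simp: disjoint_family_on_def)
  also have "(\<Union>i\<in>?J. {a \<in> F i. P a}) = {a \<in> (\<Union>i\<in>?J. F i). P a}"
    by blast
  finally show ?thesis .
qed

theorem theorem2:
  fixes G :: "('f::{field,finite} ^ 'n ^ 'n) set"
    and \<omega> \<Omega> :: "nat \<Rightarrow> ('f ^ 'n) set set"
    and q v k d m r t :: nat
  assumes "CARD('f) = q" and "CARD('n) = v"
    and "0 < k" and "0 < d" and "0 < m"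
    and "k \<le> v" and "d \<le> k"
    and "subgroup G GL"
    and "bij_betw \<omega> {1..r} (subspace_orbits G k)"
    and "bij_betw \<Omega> {1..t} (subspace_orbits G (k - d + 1))"
  shows "(\<forall>i\<in>{1..t}. \<forall>j\<in>{1..r}. \<forall>W\<in>\<Omega> i.
            orbit_matrix \<Omega> \<omega> i j = int (card {V \<in> \<omega> j. W \<subseteq> V}))
       \<and> ((\<exists>C :: ('f ^ 'n) set set.
              constant_dimension_code k C \<and> card C = m \<and> min_dist_at_least C (2 * d)
              \<and> subgroup G (automorphism_group C))
          \<longleftrightarrow>
          (\<exists>x :: nat \<Rightarrow> int.
              (\<forall>j\<in>{1..r}. x j \<in> {0, 1})
              \<and> (\<Sum>j=1..r. int (card (\<omega> j)) * x j) = int m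
              \<and> (\<forall>i\<in>{1..t}. (\<Sum>j=1..r. orbit_matrix \<Omega> \<omega> i j * x j) \<le> 1)))"
proof -
  interpret linear_group G
    using assms(8) by (rule linear_group.intro)
  have \<omega>: "\<omega> j \<in> subspace_orbits G k" if "j \<in> {1..r}" for j
    using assms(9) that by (auto simp: bij_betw_def)
  have \<Omega>: "\<Omega> i \<in> subspace_orbits G (k - d + 1)" if "i \<in> {1..t}" for i
    using assms(10) that by (auto simp: bij_betw_def)
  \<comment> \<open>Independence of the representative is the first conjunct of the claim; it also
    allows each row to be evaluated at every \<open>W\<close> of its orbit.\<close>
  have M: "\<forall>i\<in>{1..t}. \<forall>j\<in>{1..r}. \<forall>W\<in>\<Omega> i.
      orbit_matrix \<Omega> \<omega> i j = int (card {V \<in> \<omega> j. W \<subseteq> V})"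
    using \<omega> \<Omega> orbit_matrix_eq by blast
  have disj: "disjoint_family_on \<omega> {1..r}"
    unfolding disjoint_family_on_def
  proof (intro ballI impI)
    fix i j assume ij: "i \<in> {1..r}" "j \<in> {1..r}" "i \<noteq> j"
    then have "\<omega> i \<noteq> \<omega> j"
      using assms(9) by (auto simp: bij_betw_def dest: inj_onD)
    then show "\<omega> i \<inter> \<omega> j = {}"
      using disjointD[OF disjoint_subspace_orbits \<omega>[OF ij(1)] \<omega>[OF ij(2)]] by blast
  qed
  \<comment> \<open>Both directions go through this map: its values are invariant codes, and
    \<open>code_exists\<close> below shows that 0/1 vectors reach every invariant code.\<close>
  define code where "code x = (\<Union>j\<in>{j\<in>{1..r}. x j = 1}. \<omega> j)" for x :: "nat \<Rightarrow> int"
  have code_subspaces: "code x \<subseteq> subspaces k" for x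
    using \<omega> orbit_subset_subspaces by (fastforce simp: code_def)
  have code_invariant: "map_space A ` code x = code x" if "A \<in> G" for A x
    unfolding code_def image_UN using map_space_image_orbit[OF \<omega> that]
    by (intro SUP_cong) auto
  have sum_code: "(\<Sum>j=1..r. int (card {V \<in> \<omega> j. P V}) * x j) = int (card {V \<in> code x. P V})"
    if "\<forall>j\<in>{1..r}. x j \<in> {0, 1}" for x P
    unfolding code_def using disj that by (intro sum_card_selected) auto
  have card_code: "(\<Sum>j=1..r. int (card (\<omega> j)) * x j) = int (card (code x))"
    if "\<forall>j\<in>{1..r}. x j \<in> {0, 1}" for x
    using sum_code[OF that, of "\<lambda>_. True"] by simp
  have rows_code: "(\<forall>i\<in>{1..t}. (\<Sum>j=1..r. orbit_matrix \<Omega> \<omega> i j * x j) \<le> 1)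
      \<longleftrightarrow> min_dist_at_least (code x) (2 * d)" if x: "\<forall>j\<in>{1..r}. x j \<in> {0, 1}" for x
  proof -
    have row: "(\<Sum>j=1..r. orbit_matrix \<Omega> \<omega> i j * x j) = int (card {V \<in> code x. W \<subseteq> V})"
      if "i \<in> {1..t}" "W \<in> \<Omega> i" for i W
      using M that sum_code[OF x, of "\<lambda>V. W \<subseteq> V"] by simp
    have "(\<forall>i\<in>{1..t}. (\<Sum>j=1..r. orbit_matrix \<Omega> \<omega> i j * x j) \<le> 1)
        \<longleftrightarrow> (\<forall>i\<in>{1..t}. \<forall>W\<in>\<Omega> i. card {V \<in> code x. W \<subseteq> V} \<le> 1)"
    proof (intro ball_cong refl)
      fix i assume i: "i \<in> {1..t}"
      \<comment> \<open>For an empty orbit the condition over all \<open>W\<close> would hold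
        vacuously and say nothing about the row.\<close>
      have "\<Omega> i \<noteq> {}"
        using orbit_nonempty[OF \<Omega>[OF i]] .
      then show "(\<Sum>j=1..r. orbit_matrix \<Omega> \<omega> i j * x j) \<le> 1
          \<longleftrightarrow> (\<forall>W\<in>\<Omega> i. card {V \<in> code x. W \<subseteq> V} \<le> 1)"
        using row[OF i] by fastforce
    qed
    also have "\<dots> \<longleftrightarrow> (\<forall>W\<in>subspaces (k - d + 1). card {V \<in> code x. W \<subseteq> V} \<le> 1)"
    proof -
      \<comment> \<open>The numbered orbits exhaust the subspaces of this dimension, so the rows
        together test every \<open>W\<close>.\<close>
      have "subspaces (k - d + 1) = (\<Union>i\<in>{1..t}. \<Omega> i)"
        unfolding Union_subspace_orbits[symmetric] bij_betw_imp_surj_on[OF assms(10), symmetric] ..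
      then show ?thesis
        by simp
    qed
    also have "\<dots> \<longleftrightarrow> min_dist_at_least (code x) (2 * d)"
      using min_dist_at_least_iff[OF code_subspaces assms(4,7)] by simp
    finally show ?thesis .
  qed
  have code_exists: "\<exists>x. (\<forall>j\<in>{1..r}. x j \<in> {0, 1}) \<and> code x = C"
    if C: "C \<subseteq> subspaces k" "\<forall>A\<in>G. map_space A ` C = C" for C
  proof (intro exI conjI)
    \<comment> \<open>The indicator of the orbits lying inside \<open>C\<close>; by invariance their
      union is all of \<open>C\<close>.\<close>
    let ?x = "\<lambda>j. if \<omega> j \<subseteq> C then 1 else 0 :: int"
    show "\<forall>j\<in>{1..r}. ?x j \<in> {0, 1}"
      by simp
    have "code ?x = \<Union> {X \<in> \<omega> ` {1..r}. X \<subseteq> C}"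
    proof -
      have "{j \<in> {1..r}. ?x j = 1} = {j \<in> {1..r}. \<omega> j \<subseteq> C}"
        by auto
      then show ?thesis
        unfolding code_def by blast
    qed
    also have "\<omega> ` {1..r} = subspace_orbits G k"
      using assms(9) by (simp add: bij_betw_def)
    also have "\<Union> {X \<in> subspace_orbits G k. X \<subseteq> C} = C"
      using invariant_code_eq_Union_orbits[OF C] by simp
    finally show "code ?x = C" .
  qed
  show ?thesis
  proof (intro conjI M iffI; elim exE conjE)
    fix C :: "('f ^ 'n) set set"
    assume C: "constant_dimension_code k C" "card C = m" "min_dist_at_least C (2 * d)"
      "subgroup G (automorphism_group C)"
    have "C \<subseteq> subspaces k" "\<forall>A\<in>G. map_space A ` C = C"
      using C(1,4) subgroup_automorphism_group_iff[OF subgroup_GL]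
      by (simp_all add: constant_dimension_code_def)
    then obtain x where x: "\<forall>j\<in>{1..r}. x j \<in> {0, 1}" "code x = C"
      using code_exists by metis
    have "(\<Sum>j=1..r. int (card (\<omega> j)) * x j) = int m"
      using card_code[OF x(1)] x(2) C(2) by simp
    moreover have "\<forall>i\<in>{1..t}. (\<Sum>j=1..r. orbit_matrix \<Omega> \<omega> i j * x j) \<le> 1"
      using rows_code[OF x(1)] x(2) C(3) by simp
    ultimately show "\<exists>x :: nat \<Rightarrow> int. (\<forall>j\<in>{1..r}. x j \<in> {0, 1})
        \<and> (\<Sum>j=1..r. int (card (\<omega> j)) * x j) = int m
        \<and> (\<forall>i\<in>{1..t}. (\<Sum>j=1..r. orbit_matrix \<Omega> \<omega> i j * x j) \<le> 1)"
      using x(1) by (intro exI[of _ x] conjI)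
  next
    fix x :: "nat \<Rightarrow> int"
    assume x: "\<forall>j\<in>{1..r}. x j \<in> {0, 1}" "(\<Sum>j=1..r. int (card (\<omega> j)) * x j) = int m"
      "\<forall>i\<in>{1..t}. (\<Sum>j=1..r. orbit_matrix \<Omega> \<omega> i j * x j) \<le> 1"
    have "card (code x) = m"
      using card_code[OF x(1)] x(2) by simp
    moreover have "min_dist_at_least (code x) (2 * d)"
      using rows_code[OF x(1)] x(3) by (rule iffD1)
    moreover have "subgroup G (automorphism_group (code x))"
      unfolding subgroup_automorphism_group_iff[OF subgroup_GL] using code_invariant by simp
    ultimately show "\<exists>C :: ('f ^ 'n) set set. constant_dimension_code k C \<and> card C = m
        \<and> min_dist_at_least C (2 * d) \<and> subgroup G (automorphism_group C)"
      using code_subspaces unfolding constant_dimension_code_def by (intro exI[of _ "code x"] conjI)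
  qed
qed

end
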